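(* There is an absolute constant $c>0$ such that the following holds. Let $M\ge3/2$ and let $p(t)=\sum_{i=1}^\infty c_it^i$ be a power series with complex coefficients $c_i\in\mathbb{C}$ such that $c_1=1$ and $\sum_{i=1}^\infty|c_i|\le M$. Then $$\sup_{t\in[0,1]}|p(t)|\;\ge\;\frac{c}{\log^2M}.$$ *)

theory Defs
  imports "HOL-Analysis.Analysis"
begin

end

theory Submission
  imports Defs
begin

text \<open>
  With \<open>s\<^sub>j = sin\<^sup>2 (\<pi>j/2n)\<close>, the functional
  \<open>L f = \<Sum>\<^bsub>0 < j < 2n\<^esub> (-1)\<^sup>j f(s\<^sub>j/4) / s\<^sub>j\<close> maps \<open>t\<close> to \<open>-1/4\<close> and kills
  \<open>t\<^sup>i\<close> for \<open>2 \<le> i \<le> n\<close>, because \<open>sin\<^sup>2\<^sup>m\<close> is a trigonometric polynomial of low degree. Since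
  \<open>\<Sum>\<^sub>j 1/s\<^sub>j \<le> 4n\<^sup>2\<close>, it is bounded by \<open>4n\<^sup>2\<close> in the supremum norm, an endpoint Markov inequality.
  The terms with \<open>i > n\<close> contribute at most \<open>2n M / 4\<^sup>n\<^sup>+\<^sup>1\<close>, which is negligible once
  \<open>2\<^sup>n \<ge> 2M\<close>; so \<open>n\<close> of order \<open>ln M\<close> suffices.
\<close>

section \<open>Orthogonality of alternating trigonometric sums\<close>

text \<open>The sum is the real part of a full geometric sum whose ratio is a \<open>2*n\<close>-th
  root of unity different from 1.\<close>

lemma alternating_cos_sum:
  fixes n :: nat and r :: int
  assumes "\<bar>r\<bar> < int n"
  shows "(\<Sum>j<2*n. (-1)^j * cos (2 * of_int r * (pi * real j / real (2*n)))) = 0"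
proof -
  have n: "n > 0" using assms by linarith
  \<comment> \<open>The summand \<open>real n\<close> adds \<open>pi\<close> to the angle, so that
    powers of \<open>cis a\<close> absorb the sign \<open>(-1)^j\<close>.\<close>
  define a where "a = pi * (of_int r + real n) / real n"
  have summand: "(-1)^j * cos (2 * of_int r * (pi * real j / real (2*n))) = Re (cis a ^ j)" for j
  proof -
    have "real j * a = 2 * of_int r * (pi * real j / real (2*n)) + real j * pi"
      using n by (simp add: a_def field_simps)
    then show ?thesis
      by (simp add: Complex.DeMoivre cos_add)
  qed
  have "cis a \<noteq> 1"
  proof
    assume "cis a = 1"
    then have "cos a = 1" by (metis cis.sel(1) one_complex.sel(1))
    then obtain k :: int where "a = of_int k * 2 * pi"
      by (auto simp: cos_one_2pi_int)
    then have "pi * (of_int r + real n) = pi * (of_int k * 2 * real n)"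
      using n by (simp add: a_def field_simps)
    then have "of_int r + real n = of_int k * 2 * real n"
      by (simp only: mult_cancel_left pi_neq_zero simp_thms)
    then have k: "r + int n = k * (2 * int n)"
      by (metis (mono_tags, lifting) mult.assoc of_int_add of_int_eq_iff of_int_mult of_int_numeral of_int_of_nat_eq)
    \<comment> \<open>Since \<open>\<bar>r\<bar> < int n\<close>, the number
      \<open>r + int n\<close> lies strictly between two consecutive multiples of
      \<open>2 * int n\<close>.\<close>
    have "0 < k * (2 * int n)" "k * (2 * int n) < 1 * (2 * int n)"
      using assms k by linarith+
    then have "0 < k" "k < 1"
      using n by (auto simp: zero_less_mult_iff)
    then show False by linarith
  qed
  moreover have "cis a ^ (2*n) = 1"
  proof -
    have "real (2*n) * a = 2 * pi * of_int (r + int n)"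
      using n by (simp add: a_def field_simps)
    then have "cis a ^ (2*n) = cis (2 * pi * of_int (r + int n))"
      by (simp only: Complex.DeMoivre)
    then show ?thesis by (simp only: cis_multiple_2pi Ints_of_int)
  qed
  ultimately have "(\<Sum>j<2*n. cis a ^ j) = 0"
    using geometric_sum[of "cis a" "2*n"] by simp
  then show ?thesis
    unfolding summand by (metis Re_sum zero_complex.sel(1))
qed

text \<open>Multiplying by \<open>sin x ^ 2\<close> only mixes the frequencies \<open>r - 1\<close>,
  \<open>r\<close> and \<open>r + 1\<close>. Each induction step thus uses up one unit of the room
  between \<open>\<bar>r\<bar>\<close> and \<open>n\<close>, which is why \<open>r\<close> is kept
  general although only \<open>r = 0\<close> is needed later.\<close>

lemma alternating_sin_power_cos_sum:
  fixes n m :: nat and r :: int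
  assumes "\<bar>r\<bar> + int m < int n"
  shows "(\<Sum>j<2*n. (-1)^j * sin (pi * real j / real (2*n)) ^ (2*m)
            * cos (2 * of_int r * (pi * real j / real (2*n)))) = 0"
  using assms
proof (induction m arbitrary: r)
  case 0
  then show ?case using alternating_cos_sum[of r n] by simp
next
  case (Suc m)
  let ?x = "\<lambda>j. pi * real j / real (2*n)"
  let ?A = "\<lambda>r::int. \<Sum>j<2*n. (-1)^j * sin (?x j) ^ (2*m) * cos (2 * of_int r * ?x j)"
  have trig: "sin x ^ 2 * cos (2 * of_int r * x)
      = cos (2 * of_int r * x) / 2 - cos (2 * of_int (r+1) * x) / 4 - cos (2 * of_int (r-1) * x) / 4"
    for x :: real
  proof -
    have "cos (2 * of_int (r+1) * x) = cos (2 * of_int r * x + 2 * x)"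
      "cos (2 * of_int (r-1) * x) = cos (2 * of_int r * x - 2 * x)"
      by (simp_all add: algebra_simps)
    then have "cos (2 * of_int (r+1) * x) + cos (2 * of_int (r-1) * x)
        = 2 * (cos (2 * of_int r * x) * cos (2 * x))"
      by (simp only: cos_add cos_diff)
    also have "cos (2 * of_int r * x) * cos (2 * x)
        = cos (2 * of_int r * x) - 2 * (sin x ^ 2 * cos (2 * of_int r * x))"
      unfolding cos_double_sin[of x] by (simp add: right_diff_distrib)
    finally have "cos (2 * of_int (r+1) * x) + cos (2 * of_int (r-1) * x)
        = 2 * (cos (2 * of_int r * x) - 2 * (sin x ^ 2 * cos (2 * of_int r * x)))" .
    moreover have "v = u/2 - p/4 - q/4" if "p + q = 2 * (u - 2 * v)" for p q u v :: real
      using that by simp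
    ultimately show ?thesis by blast
  qed
  have "(\<Sum>j<2*n. (-1)^j * sin (?x j) ^ (2 * Suc m) * cos (2 * of_int r * ?x j))
      = (\<Sum>j<2*n. (-1)^j * sin (?x j) ^ (2*m) * (sin (?x j) ^ 2 * cos (2 * of_int r * ?x j)))"
    by (simp add: power2_eq_square mult_ac)
  also have "\<dots> = ?A r / 2 - ?A (r+1) / 4 - ?A (r-1) / 4"
    unfolding trig
    by (simp only: right_diff_distrib sum_subtractf sum_divide_distrib times_divide_eq_right)
  also have "?A r = 0" by (rule Suc.IH) (use Suc.prems in linarith)
  also have "?A (r+1) = 0" by (rule Suc.IH) (use Suc.prems in linarith)
  also have "?A (r-1) = 0" by (rule Suc.IH) (use Suc.prems in linarith)
  finally show ?case by simp
qed

section \<open>Size of the weights \<open>1 / s j\<close>\<close>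

text \<open>Jordan's inequality: the concave sine lies above its chord from 0 to
  \<open>pi/2\<close>.\<close>

lemma sin_ge_two_over_pi:
  fixes x :: real
  assumes "0 \<le> x" "x \<le> pi/2"
  shows "2 * x / pi \<le> sin x"
proof -
  have "convex_on {0..pi} (\<lambda>x. - sin x)"
    by (rule f''_ge0_imp_convex[where f' = "\<lambda>x. - cos x" and f'' = sin])
       (auto intro!: derivative_eq_intros sin_ge_zero)
  from convex_onD[OF this, of "2 * x / pi" 0 "pi/2"] show ?thesis
    using assms by (simp add: field_simps)
qed

text \<open>Telescoping comparison with \<open>1 / (k * (k+1))\<close>; the subtracted term makes
  the induction close, and only the bound 2 is used later.\<close>

lemma sum_inverse_squares_le: "(\<Sum>j=1..Suc k. 1 / (real j)\<^sup>2) \<le> 2 - 1 / real (Suc k)"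
proof (induction k)
  case 0
  then show ?case by simp
next
  case (Suc k)
  have "1 / (real (Suc (Suc k)))\<^sup>2 \<le> 1 / (real (Suc k) * real (Suc (Suc k)))"
    unfolding power2_eq_square by (intro divide_left_mono mult_right_mono) auto
  also have "\<dots> = 1 / real (Suc k) - 1 / real (Suc (Suc k))"
    by (simp add: field_simps)
  finally show ?case using Suc by simp
qed

lemma sin_node_pos:
  fixes j n :: nat
  assumes "j \<in> {1..<2*n}"
  shows "0 < sin (pi * real j / real (2*n))"
  using assms by (intro sin_gt_zero) (auto simp: field_simps)

text \<open>Jordan's inequality bounds the sine below by \<open>j / n\<close> for
  \<open>j \<le> n\<close>, and the reflection of \<open>j\<close> to \<open>2*n - j\<close> handles
  the other nodes. Adding both bounds at every node avoids splitting the sum and costs two sums of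
  inverse squares, each at most 2.\<close>

lemma sum_inverse_sin_squares_le:
  fixes n :: nat
  assumes "n > 0"
  shows "(\<Sum>j=1..<2*n. 1 / (sin (pi * real j / real (2*n)))\<^sup>2) \<le> 4 * (real n)\<^sup>2"
proof -
  let ?x = "\<lambda>j. pi * real j / real (2*n)"
  have half: "1 / (sin (?x j))\<^sup>2 \<le> (real n)\<^sup>2 * (1 / (real j)\<^sup>2)" if "1 \<le> j" "j \<le> n" for j
  proof -
    have "2 * ?x j / pi \<le> sin (?x j)"
      by (rule sin_ge_two_over_pi) (use that in \<open>auto simp: field_simps\<close>)
    then have "real j / real n \<le> sin (?x j)" by simp
    then have "(real j / real n)\<^sup>2 \<le> (sin (?x j))\<^sup>2"
      by (rule power_mono) simp
    then have "1 / (sin (?x j))\<^sup>2 \<le> 1 / (real j / real n)\<^sup>2"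
      using that assms by (intro divide_left_mono) (auto intro!: mult_pos_pos)
    then show ?thesis using assms that by (simp add: power_divide)
  qed
  have le: "1 / (sin (?x j))\<^sup>2 \<le> (real n)\<^sup>2 * (1 / (real j)\<^sup>2 + 1 / (real (2*n - j))\<^sup>2)"
    if "j \<in> {1..<2*n}" for j
  proof (cases "j \<le> n")
    case True
    have "1 / (sin (?x j))\<^sup>2 \<le> (real n)\<^sup>2 * (1 / (real j)\<^sup>2)"
      using half True that by simp
    also have "\<dots> \<le> (real n)\<^sup>2 * (1 / (real j)\<^sup>2 + 1 / (real (2*n - j))\<^sup>2)"
      by (intro mult_left_mono) auto
    finally show ?thesis .
  next
    case False
    have "?x (2*n - j) = pi - ?x j"
      using that assms by (simp add: of_nat_diff field_simps)
    then have "sin (?x j) = sin (?x (2*n - j))"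
      by (simp only: sin_pi_minus)
    then have "1 / (sin (?x j))\<^sup>2 \<le> (real n)\<^sup>2 * (1 / (real (2*n - j))\<^sup>2)"
      using half[of "2*n - j"] False that by simp
    also have "\<dots> \<le> (real n)\<^sup>2 * (1 / (real j)\<^sup>2 + 1 / (real (2*n - j))\<^sup>2)"
      by (intro mult_left_mono) auto
    finally show ?thesis .
  qed
  have "(\<Sum>j=1..<2*n. 1 / (real (2*n - j))\<^sup>2) = (\<Sum>j=1..<2*n. 1 / (real j)\<^sup>2)"
    by (rule sum.reindex_bij_witness[of _ "\<lambda>j. 2*n - j" "\<lambda>j. 2*n - j"]) auto
  moreover have "(\<Sum>j=1..<2*n. 1 / (real j)\<^sup>2) \<le> 2"
  proof -
    have "{1..<2*n} = {1..Suc (2*n - 2)}" using assms by auto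
    then show ?thesis
      using sum_inverse_squares_le[of "2*n - 2"]
      by (smt (verit) of_nat_0_le_iff zero_le_divide_1_iff)
  qed
  ultimately have sums: "(\<Sum>j=1..<2*n. 1 / (real j)\<^sup>2 + 1 / (real (2*n - j))\<^sup>2) \<le> 4"
    by (simp add: sum.distrib)
  have "(\<Sum>j=1..<2*n. 1 / (sin (?x j))\<^sup>2)
      \<le> (\<Sum>j=1..<2*n. (real n)\<^sup>2 * (1 / (real j)\<^sup>2 + 1 / (real (2*n - j))\<^sup>2))"
    by (rule sum_mono) (rule le)
  also have "\<dots> \<le> (real n)\<^sup>2 * 4"
    unfolding sum_distrib_left[symmetric] by (intro mult_left_mono sums) simp
  finally show ?thesis by simp
qed

section \<open>Action of the functional on powers and on the series\<close>

lemma alternating_sin_power_sum: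
  fixes n m :: nat
  assumes "0 < m" "m < n"
  shows "(\<Sum>j=1..<2*n. (-1)^j * sin (pi * real j / real (2*n)) ^ (2*m)) = 0"
proof -
  have "{..<2*n} = insert 0 {1..<2*n}" using assms by auto
  then show ?thesis
    using alternating_sin_power_cos_sum[of 0 m n] assms by (simp add: zero_power)
qed

text \<open>In contrast to positive powers of the sine, the constant 1 does not vanish at the
  excluded node \<open>j = 0\<close>, which leaves \<open>-1\<close>.\<close>

lemma alternating_sign_sum:
  fixes n :: nat
  assumes "0 < n"
  shows "(\<Sum>j=1..<2*n. (-1)^j :: real) = -1"
proof -
  have "{..<2*n} = insert 0 {1..<2*n}" using assms by auto
  then show ?thesis
    using alternating_sin_power_cos_sum[of 0 0 n] assms by simp
qed

text \<open>The functional \<open>L\<close> is evaluated on the series in two ways: termwise, giving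
  \<open>-1/4\<close> plus a tail, and through the values at the nodes, giving at most
  \<open>4 * (real n)\<^sup>2 * e\<close>.\<close>

lemma power_series_bound:
  fixes c :: "nat \<Rightarrow> complex" and n :: nat and e M :: real
  assumes n: "0 < n" and c1: "c 1 = 1"
    and sum: "summable (\<lambda>i. norm (c (Suc i)))" and le_M: "(\<Sum>i. norm (c (Suc i))) \<le> M"
    and le_e: "\<And>t. t \<in> {0..1} \<Longrightarrow> norm (\<Sum>i. c (Suc i) * of_real t ^ Suc i) \<le> e"
  shows "1 / 4 \<le> 4 * (real n)\<^sup>2 * e + 2 * real n * M * (1/4) ^ Suc n"
proof -
  define f where "f t = (\<Sum>i. c (Suc i) * of_real t ^ Suc i)" for t :: real
  define s where "s j = (sin (pi * real j / real (2*n)))\<^sup>2" for j :: nat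
  define J where "J = {1..<2*n}"
  \<comment> \<open>Dividing by \<open>s j\<close> lowers the exponent by one: \<open>L\<close> maps
    the power \<open>Suc i\<close> of \<open>t\<close> to \<open>(1/4) ^ Suc i * B i\<close>, so
    \<open>g i\<close> is the image of the term of degree \<open>Suc i\<close>.\<close>
  define B where "B i = (\<Sum>j\<in>J. (-1)^j * s j ^ i)" for i :: nat
  define g where "g i = c (Suc i) * of_real ((1/4) ^ Suc i * B i)" for i :: nat
  have finJ: "finite J" and cardJ: "card J \<le> 2*n" by (auto simp: J_def)
  have s_pos: "0 < s j" if "j \<in> J" for j
    using sin_node_pos[of j n] that by (simp add: s_def J_def)
  have s_le: "s j \<le> 1" for j
    by (simp add: s_def abs_square_le_1)
  have s_nonneg: "0 \<le> s j" for j by (simp add: s_def)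
  have B0: "B 0 = -1"
    using alternating_sign_sum[OF n] by (simp add: B_def J_def)
  have B_zero: "B i = 0" if "0 < i" "i < n" for i
    using alternating_sin_power_sum[OF that] by (simp add: B_def J_def s_def power_mult)
  have B_le: "\<bar>B i\<bar> \<le> 2 * real n" for i
  proof -
    have "\<bar>B i\<bar> \<le> (\<Sum>j\<in>J. 1)"
      unfolding B_def using s_le s_nonneg
      by (intro order_trans[OF sum_abs] sum_mono) (auto simp: abs_mult power_le_one)
    then show ?thesis using cardJ by simp
  qed
  have sum_t: "summable (\<lambda>i. c (Suc i) * of_real t ^ Suc i)" if "0 \<le> t" "t \<le> 1" for t :: real
  proof (rule summable_comparison_test'[OF sum])
    fix i :: nat
    have "norm (complex_of_real t ^ Suc i) \<le> 1"
      using that by (simp add: norm_power norm_mult mult_le_one power_le_one del: power_Suc)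
    then show "norm (c (Suc i) * complex_of_real t ^ Suc i) \<le> norm (c (Suc i))"
      unfolding norm_mult by (rule mult_left_le) simp
  qed
  have g_sums: "g sums (\<Sum>j\<in>J. of_real ((-1)^j / s j) * f (s j / 4))"
  proof -
    have "(\<lambda>i. \<Sum>j\<in>J. of_real ((-1)^j / s j) * (c (Suc i) * of_real (s j / 4) ^ Suc i))
        sums (\<Sum>j\<in>J. of_real ((-1)^j / s j) * f (s j / 4))"
      unfolding f_def
      by (intro sums_sum sums_mult summable_sums sum_t) (auto simp: s_nonneg intro: order_trans[OF s_le])
    moreover have "(\<Sum>j\<in>J. of_real ((-1)^j / s j) * (c (Suc i) * of_real (s j / 4) ^ Suc i)) = g i" for i
    proof -
      have "complex_of_real ((-1)^j / s j) * (c (Suc i) * of_real (s j / 4) ^ Suc i)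
          = c (Suc i) * of_real ((1/4) ^ Suc i * ((-1)^j * s j ^ i))" if "j \<in> J" for j
      proof -
        have "(-1)^j / s j * (s j / 4) ^ Suc i = (1/4) ^ Suc i * ((-1)^j * s j ^ i)"
          using s_pos[OF that] by (simp add: field_simps)
        from arg_cong[OF this, of complex_of_real] show ?thesis
          by (simp only: of_real_mult of_real_power mult_ac)
      qed
      then show ?thesis
        by (simp add: g_def B_def sum_distrib_left cong: sum.cong)
    qed
    ultimately show ?thesis by simp
  qed
  \<comment> \<open>Terms of degree 2 to \<open>n\<close> vanish. Beyond that the nodes
    \<open>s j / 4\<close> lie in \<open>[0, 1/4]\<close>, and this scaling supplies the geometric
    decay.\<close>
  have tail: "norm (g (Suc i)) \<le> 2 * real n * (1/4) ^ Suc n * norm (c (Suc (Suc i)))" for i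
  proof (cases "Suc i < n")
    case True
    then show ?thesis using B_zero[of "Suc i"] by (simp add: g_def)
  next
    case False
    have "(1/4::real) ^ Suc (Suc i) \<le> (1/4) ^ Suc n"
      using False by (intro power_decreasing) auto
    then have "(1/4) ^ Suc (Suc i) * \<bar>B (Suc i)\<bar> \<le> (1/4) ^ Suc n * (2 * real n)"
      by (intro mult_mono B_le) auto
    then have "norm (c (Suc (Suc i))) * ((1/4) ^ Suc (Suc i) * \<bar>B (Suc i)\<bar>)
        \<le> norm (c (Suc (Suc i))) * ((1/4) ^ Suc n * (2 * real n))"
      by (rule mult_left_mono) simp
    then show ?thesis
      by (simp add: g_def norm_mult norm_power abs_mult mult_ac)
  qed
  have sum': "summable (\<lambda>i. norm (c (Suc (Suc i))))"
    using sum by (subst summable_Suc_iff)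
  have tail_sum: "(\<Sum>i. norm (c (Suc (Suc i)))) \<le> M"
    using suminf_split_head[OF sum] le_M c1 by simp
  have "norm (\<Sum>i. g (Suc i)) \<le> (\<Sum>i. 2 * real n * (1/4) ^ Suc n * norm (c (Suc (Suc i))))"
    by (rule norm_suminf_le[OF tail]) (intro summable_mult sum')
  also have "\<dots> = 2 * real n * (1/4) ^ Suc n * (\<Sum>i. norm (c (Suc (Suc i))))"
    by (rule suminf_mult[OF sum'])
  also have "\<dots> \<le> 2 * real n * (1/4) ^ Suc n * M"
    by (intro mult_left_mono tail_sum) simp
  finally have tail_le: "norm (\<Sum>i. g (Suc i)) \<le> 2 * real n * (1/4) ^ Suc n * M" .
  have "norm (\<Sum>i. g i) = norm (\<Sum>j\<in>J. of_real ((-1)^j / s j) * f (s j / 4))"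
    using g_sums by (simp add: sums_iff)
  also have "\<dots> \<le> (\<Sum>j\<in>J. 1 / s j * e)"
  proof (rule sum_norm_le)
    fix j assume j: "j \<in> J"
    have "norm (f (s j / 4)) \<le> e"
      unfolding f_def by (rule le_e) (auto simp: s_nonneg intro: order_trans[OF s_le])
    then show "norm (complex_of_real ((-1)^j / s j) * f (s j / 4)) \<le> 1 / s j * e"
      using s_pos[OF j] by (simp add: norm_mult norm_divide norm_power divide_right_mono)
  qed
  also have "\<dots> = (\<Sum>j\<in>J. 1 / s j) * e"
    by (rule sum_distrib_right[symmetric])
  also have "\<dots> \<le> 4 * (real n)\<^sup>2 * e"
  proof (rule mult_right_mono)
    show "(\<Sum>j\<in>J. 1 / s j) \<le> 4 * (real n)\<^sup>2"
      using sum_inverse_sin_squares_le[OF n] by (simp add: J_def s_def)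
    show "0 \<le> e" using le_e[of 0] norm_ge_zero order_trans by fastforce
  qed
  finally have total_le: "norm (\<Sum>i. g i) \<le> 4 * (real n)\<^sup>2 * e" .
  have "g 0 = - (1/4)" using c1 B0 by (simp add: g_def)
  moreover have "(\<Sum>i. g i) = g 0 + (\<Sum>i. g (Suc i))"
    using suminf_split_head[OF sums_summable[OF g_sums]] by simp
  ultimately have "(1/4::complex) = (\<Sum>i. g (Suc i)) - (\<Sum>i. g i)" by simp
  then have "norm (1/4::complex) \<le> norm (\<Sum>i. g (Suc i)) + norm (\<Sum>i. g i)"
    by (metis norm_triangle_ineq4)
  then show ?thesis using tail_le total_le by (simp add: mult_ac)
qed

section \<open>Choice of \<open>n\<close> and the final constant\<close>

lemma exists_power_scale:
  fixes M :: real
  assumes "M \<ge> 3/2"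
  obtains n :: nat where "0 < n" "2 * M \<le> 2 ^ n" "real n \<le> 8 * ln M"
proof -
  define n where "n = nat \<lceil>log 2 (2*M)\<rceil>"
  have pos: "0 < log 2 (2*M)" using assms by simp
  have n: "log 2 (2*M) \<le> real n" "real n < log 2 (2*M) + 1"
    using pos unfolding n_def by linarith+
  have "2 * M = 2 powr log 2 (2*M)" using assms by simp
  also have "\<dots> \<le> 2 powr real n" using n(1) by simp
  also have "\<dots> = 2 ^ n" by (simp add: powr_realpow)
  finally have "2 * M \<le> 2 ^ n" .
  moreover have "0 < n" using n(1) pos by linarith
  \<comment> \<open>From \<open>1/2 \<le> ln 2\<close> one gets
    \<open>real n < 2 + 2 * ln M\<close>, and \<open>M \<ge> 3/2\<close> gives
    \<open>1/3 \<le> ln M\<close>, so the 2 is at most \<open>6 * ln M\<close>.\<close>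
  moreover have "real n \<le> 8 * ln M"
  proof -
    have ln_ge: "1 - 1/x \<le> ln x" if "x > 0" for x :: real
      using ln_le_minus_one[of "1/x"] that by (simp add: ln_div)
    have "1/2 \<le> ln (2::real)" using ln_ge[of 2] by simp
    moreover have "0 \<le> ln M" using assms by simp
    ultimately have "ln M / ln 2 \<le> ln M / (1/2)"
      by (intro divide_left_mono) auto
    then have "ln M / ln 2 \<le> 2 * ln M" by simp
    moreover have "log 2 (2*M) = 1 + ln M / ln 2"
      using assms by (simp add: log_def ln_mult add_divide_distrib)
    moreover have "1/3 \<le> ln M"
    proof -
      have "1 / M \<le> 2/3" using assms by (simp add: field_simps)
      then show ?thesis using ln_ge[of M] assms by linarith
    qed
    ultimately show ?thesis using n(2) by linarith
  qed
  ultimately show ?thesis using that by blast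
qed

theorem lemma13:
  shows "\<exists>C::real. C > 0 \<and>
    (\<forall>(M::real) (c :: nat \<Rightarrow> complex).
       M \<ge> 3 / 2 \<longrightarrow>
       c 1 = 1 \<longrightarrow>
       summable (\<lambda>i. norm (c (Suc i))) \<longrightarrow>
       (\<Sum>i. norm (c (Suc i))) \<le> M \<longrightarrow>
       (SUP t\<in>{0..1::real}. norm (\<Sum>i. c (Suc i) * of_real t ^ Suc i)) \<ge> C / (ln M)\<^sup>2)"
proof (intro exI[of _ "1/2048"] conjI allI impI)
  fix M :: real and c :: "nat \<Rightarrow> complex"
  assume M: "M \<ge> 3/2" and c1: "c 1 = 1"
    and sum: "summable (\<lambda>i. norm (c (Suc i)))" and le_M: "(\<Sum>i. norm (c (Suc i))) \<le> M"
  let ?f = "\<lambda>t::real. norm (\<Sum>i. c (Suc i) * of_real t ^ Suc i)"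
  define e where "e = (SUP t\<in>{0..1::real}. ?f t)"
  \<comment> \<open>A real supremum bounds its members only if the set is bounded above; the
    coefficient sum provides such a bound.\<close>
  have "?f t \<le> M" if "t \<in> {0..1}" for t
  proof -
    have "norm (c (Suc i) * complex_of_real t ^ Suc i) \<le> norm (c (Suc i))" for i
    proof -
      have "norm (complex_of_real t ^ Suc i) \<le> 1"
        using that by (simp add: norm_power power_le_one del: power_Suc)
      then show ?thesis unfolding norm_mult by (rule mult_left_le) simp
    qed
    from norm_suminf_le[OF this sum] le_M show ?thesis by linarith
  qed
  then have "bdd_above (?f ` {0..1})" by (rule bdd_aboveI2)
  then have le_e: "?f t \<le> e" if "t \<in> {0..1}" for t
    unfolding e_def using that by (rule cSUP_upper2) auto
  obtain n :: nat where n: "0 < n" "2 * M \<le> 2 ^ n" "real n \<le> 8 * ln M"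
    using exists_power_scale[OF M] .
  have "2 * real n \<le> 2 ^ n"
  proof -
    obtain m where "n = Suc m" using n(1) gr0_implies_Suc by blast
    moreover have "real (Suc m) \<le> 2 ^ m"
      using less_exp[of m] by (metis Suc_leI of_nat_le_iff of_nat_numeral of_nat_power)
    ultimately show ?thesis by simp
  qed
  \<comment> \<open>One factor \<open>2 ^ n\<close> absorbs \<open>2 * real n\<close> and the other
    absorbs \<open>2 * M\<close>, so the tail costs at most half of \<open>1/4\<close>.\<close>
  then have "(2 * real n) * (2 * M) \<le> 2 ^ n * 2 ^ n"
    using n(2) M by (intro mult_mono) auto
  also have "\<dots> = (4::real) ^ n" by (simp flip: power_mult_distrib)
  finally have "2 * real n * M * (1/4) ^ Suc n \<le> 1/8"
    by (simp add: field_simps)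
  moreover have "1 / 4 \<le> 4 * (real n)\<^sup>2 * e + 2 * real n * M * (1/4) ^ Suc n"
    using power_series_bound[OF n(1) c1 sum le_M le_e] .
  ultimately have main: "1 / 32 \<le> (real n)\<^sup>2 * e" by linarith
  have "0 \<le> e" using le_e[of 0] by simp
  have "(real n)\<^sup>2 * e \<le> (8 * ln M)\<^sup>2 * e"
    using n(3) \<open>0 \<le> e\<close> by (intro mult_right_mono power_mono) auto
  \<comment> \<open>The constant is 2048 = 32 * 64, with 64 coming from the square of
    \<open>8 * ln M\<close>.\<close>
  with main have "1 / 2048 \<le> (ln M)\<^sup>2 * e" by (simp add: power_mult_distrib)
  moreover have "0 < (ln M)\<^sup>2" using M by simp
  ultimately show "1 / 2048 / (ln M)\<^sup>2 \<le> (SUP t\<in>{0..1}. ?f t)"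
    unfolding e_def[symmetric] by (simp add: field_simps)
qed simp

end
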